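(* For all integers $n\geq 5$ and $p\geq 0$, $$\mathcal{A}(C_{n}\cup pK_1)>\mathcal{A}(C_{n-2}\cup (p+2)K_1).$$
   Context: Graphs are finite and simple. For a graph $G$ and an integer $k$, $S(G,k)$ is the number of partitions of the vertex set of $G$ into exactly $k$ nonempty stable sets (sets of pairwise non-adjacent vertices). Put $\mathcal{B}(G)=\sum_{k}S(G,k)$, $\mathcal{T}(G)=\sum_{k}k\,S(G,k)$ and $\mathcal{A}(G)=\mathcal{T}(G)/\mathcal{B}(G)$ (the average number of colors in the non-equivalent colorings of $G$). $C_n$ is the cycle on $n$ vertices, and $G\cup pK_1$ is the graph obtained from $G$ by adding $p$ isolated vertices. *)

theory Defs
  imports Complex_Main "HOL-Library.Disjoint_Sets" "Graph_Theory.Pair_Digraph"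
begin

text \<open>
  A finite simple graph is a value of type \<^typ>\<open>'a pair_pre_digraph\<close> in the locale
  \<^locale>\<open>pair_graph\<close>: an undirected edge between \<open>u\<close> and \<open>v\<close> is represented by the two arcs
  \<open>(u, v)\<close> and \<open>(v, u)\<close>.
\<close>

definition stable_set :: "'a pair_pre_digraph \<Rightarrow> 'a set \<Rightarrow> bool" where
  "stable_set G A \<longleftrightarrow> A \<subseteq> pverts G \<and> (\<forall>u\<in>A. \<forall>v\<in>A. (u, v) \<notin> parcs G)"

text \<open>The blocks of a \<^const>\<open>partition_on\<close> are nonempty by definition.\<close>

definition stable_partitions :: "'a pair_pre_digraph \<Rightarrow> nat \<Rightarrow> 'a set set set" where
  "stable_partitions G k =
     {P. partition_on (pverts G) P \<and> card P = k \<and> (\<forall>A\<in>P. stable_set G A)}"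

definition graphical_stirling :: "'a pair_pre_digraph \<Rightarrow> nat \<Rightarrow> nat" where
  "graphical_stirling G k = card (stable_partitions G k)"

text \<open>
  The sums below range over all \<open>k\<close> in the mathematics; for a finite graph the terms with
  \<open>k > card (pverts G)\<close> vanish.
\<close>

lemma graphical_stirling_eq_0:
  assumes "finite (pverts G)" "card (pverts G) < k"
  shows "graphical_stirling G k = 0"
proof -
  have "stable_partitions G k = {}"
  proof (rule ccontr)
    assume "stable_partitions G k \<noteq> {}"
    then obtain P where P: "partition_on (pverts G) P" "card P = k"
      unfolding stable_partitions_def by blast
    have "\<exists>f. \<forall>A\<in>P. f A \<in> A"
      using partition_onD3[OF P(1)] by (metis all_not_in_conv)
    then obtain f where f: "\<And>A. A \<in> P \<Longrightarrow> f A \<in> A" by blast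
    have "inj_on f P"
      using f partition_onD2[OF P(1)] unfolding inj_on_def disjoint_def
      by (metis IntI empty_iff)
    moreover have "f ` P \<subseteq> pverts G"
      using f partition_onD1[OF P(1)] by blast
    ultimately have "card P \<le> card (pverts G)"
      using assms(1) by (rule card_inj_on_le)
    with P(2) assms(2) show False by simp
  qed
  then show ?thesis by (simp add: graphical_stirling_def)
qed

definition graphical_bell :: "'a pair_pre_digraph \<Rightarrow> nat" where
  "graphical_bell G = (\<Sum>k\<le>card (pverts G). graphical_stirling G k)"

definition total_colors :: "'a pair_pre_digraph \<Rightarrow> nat" where
  "total_colors G = (\<Sum>k\<le>card (pverts G). k * graphical_stirling G k)"

definition avg_colors :: "'a pair_pre_digraph \<Rightarrow> real" where
  "avg_colors G = real (total_colors G) / real (graphical_bell G)"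

text \<open>This is the cycle with \<open>n\<close> vertices only for \<open>n \<ge> 3\<close>.\<close>

definition cycle_graph :: "nat \<Rightarrow> nat pair_pre_digraph" where
  "cycle_graph n =
     \<lparr> pverts = {..<n},
       parcs = {(i, j). i < n \<and> j < n \<and> (j = Suc i mod n \<or> i = Suc j mod n)} \<rparr>"

lemma pair_graph_cycle_graph:
  assumes "3 \<le> n"
  shows "pair_graph (cycle_graph n)"
proof
  have "parcs (cycle_graph n) \<subseteq> {..<n} \<times> {..<n}"
    by (auto simp: cycle_graph_def)
  then show "finite (parcs (cycle_graph n))"
    by (rule finite_subset) simp
  fix e assume e: "e \<in> parcs (cycle_graph n)"
  have "Suc i mod n \<noteq> i" if "i < n" for i
    using that assms by (simp add: mod_Suc)
  then show "fst e \<noteq> snd e"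
    using e by (force simp: cycle_graph_def)
qed (auto simp: cycle_graph_def symmetric_def sym_def)

text \<open>The \<open>p\<close> new vertices are \<open>Inr 0, \<dots>, Inr (p - 1)\<close>, disjoint from the copy of \<open>G\<close>.\<close>

definition add_isolated :: "'a pair_pre_digraph \<Rightarrow> nat \<Rightarrow> ('a + nat) pair_pre_digraph" where
  "add_isolated G p =
     \<lparr> pverts = Inl ` pverts G \<union> Inr ` {..<p},
       parcs = {(Inl u, Inl v) |u v. (u, v) \<in> parcs G} \<rparr>"

lemma pair_graph_add_isolated:
  assumes "pair_graph G"
  shows "pair_graph (add_isolated G p)"
proof -
  interpret pair_graph G by fact
  have "parcs (add_isolated G p) = map_prod Inl Inl ` parcs G"
    by (force simp: add_isolated_def)
  then have "finite (parcs (add_isolated G p))"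
    using pair_finite_arcs by simp
  then show ?thesis
    using pair_finite_verts pair_no_loops pair_sym_arcs
    by unfold_locales
      (auto simp: add_isolated_def symmetric_def sym_def dest: in_arcsD1 in_arcsD2)
qed

end

theory Submission
  imports Defs "HOL-Library.FuncSet"
begin

text \<open>
  Let \<open>P\<^sub>G\<close> be the chromatic polynomial. Grouping colorings by their color classes gives
  \<open>P\<^sub>G(x) = \<Sum>\<^sub>k S(G,k) x(x-1)\<dots>(x-k+1)\<close>, and summing against \<open>1/x!\<close> as in Dobinski's formula yields
  \<open>\<Sum>\<^sub>x P\<^sub>G(x)/x! = e B(G)\<close> and \<open>\<Sum>\<^sub>x x P\<^sub>G(x)/x! = e (B(G) + T(G))\<close>. So \<open>A(G) + 1\<close> is the mean
  of the distribution on the naturals with weights \<open>P\<^sub>G(x)/x!\<close>. Here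
  \<open>P\<^sub>G(x) = x^p ((x-1)^n + (-1)^n (x-1))\<close> for \<open>G = C\<^sub>n \<union> pK\<^sub>1\<close>, and the ratio of this polynomial to the
  one of \<open>C\<^bsub>n-2\<^esub> \<union> (p+2)K\<^sub>1\<close> is strictly increasing on the common support, so the first
  distribution dominates the second in the likelihood ratio order and has the larger mean.
\<close>

section \<open>Colorings and stable partitions\<close>

text \<open>Taken extensional, so that functions differing only outside the vertex set are not
  counted twice.\<close>

definition proper_colorings :: "'a pair_pre_digraph \<Rightarrow> 'c set \<Rightarrow> ('a \<Rightarrow> 'c) set" where
  "proper_colorings G C =
     {f \<in> pverts G \<rightarrow>\<^sub>E C. \<forall>u\<in>pverts G. \<forall>v\<in>pverts G. (u, v) \<in> parcs G \<longrightarrow> f u \<noteq> f v}"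

definition block_coloring :: "'a set \<Rightarrow> 'a set set \<Rightarrow> ('a set \<Rightarrow> 'c) \<Rightarrow> 'a \<Rightarrow> 'c" where
  "block_coloring V P g = (\<lambda>v\<in>V. g (THE A. A \<in> P \<and> v \<in> A))"

lemma block_coloring_eq:
  assumes "partition_on V P" "A \<in> P" "v \<in> A"
  shows "block_coloring V P g v = g A"
proof -
  have "(THE B. B \<in> P \<and> v \<in> B) = A"
    using assms partition_onD2[OF assms(1)] by (intro the_equality) (auto simp: disjoint_def)
  moreover have "v \<in> V"
    using assms partition_onD1[OF assms(1)] by auto
  ultimately show ?thesis by (simp add: block_coloring_def)
qed

text \<open>Injectivity of \<open>g\<close> keeps distinct blocks from merging, so the partition can
  be read off the coloring.\<close>

lemma color_class_block_coloring:
  assumes P: "partition_on V P" and g: "inj_on g P" and A: "A \<in> P" "v \<in> A"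
  shows "{w \<in> V. block_coloring V P g w = block_coloring V P g v} = A"
proof (intro set_eqI iffI)
  fix w assume w: "w \<in> {w \<in> V. block_coloring V P g w = block_coloring V P g v}"
  then obtain B where B: "B \<in> P" "w \<in> B"
    using partition_onD1[OF P] by auto
  then have "g B = g A"
    using w block_coloring_eq[OF P B, of g] block_coloring_eq[OF P A, of g] by simp
  then show "w \<in> A" using g A B by (metis inj_onD)
next
  fix w assume "w \<in> A"
  then show "w \<in> {w \<in> V. block_coloring V P g w = block_coloring V P g v}"
    using block_coloring_eq[OF P A(1), of _ g] A partition_onD1[OF P] by auto
qed

text \<open>A coloring amounts to its color classes together with distinct colors for them; the
  inverse map collects vertices of equal color.\<close>

lemma bij_betw_block_coloring:
  fixes G :: "'a pair_pre_digraph" and C :: "'c set"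
  shows "bij_betw (\<lambda>(P, g). block_coloring (pverts G) P g)
     (SIGMA P:{P. partition_on (pverts G) P \<and> (\<forall>A\<in>P. stable_set G A)}.
        {g \<in> P \<rightarrow>\<^sub>E C. inj_on g P})
     (proper_colorings G C)"
    (is "bij_betw ?h (Sigma ?Q ?I) _")
proof -
  define V where "V = pverts G"
  have "inj_on ?h (Sigma ?Q ?I)"
  proof (rule inj_onI, clarify)
    fix P P' :: "'a set set" and g g' :: "'a set \<Rightarrow> 'c"
    assume P: "partition_on (pverts G) P" "inj_on g P" "g \<in> P \<rightarrow>\<^sub>E C"
      and P': "partition_on (pverts G) P'" "inj_on g' P'" "g' \<in> P' \<rightarrow>\<^sub>E C"
      and eq: "block_coloring (pverts G) P g = block_coloring (pverts G) P' g'"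
    \<comment> \<open>Every block of \<open>P1\<close> is a color class of the common coloring,
      hence a block of \<open>P2\<close>. Stated for generic pairs so that it applies in both
      directions.\<close>
    have sub: "P1 \<subseteq> P2" if h: "partition_on V P1" "inj_on g1 P1" "partition_on V P2" "inj_on g2 P2"
       "block_coloring V P1 g1 = block_coloring V P2 g2"
      for P1 P2 :: "'a set set" and g1 g2 :: "'a set \<Rightarrow> 'c"
    proof
      fix A assume A: "A \<in> P1"
      then obtain v where v: "v \<in> A" using partition_onD3[OF h(1)] by (metis all_not_in_conv)
      then have "v \<in> V" using A partition_onD1[OF h(1)] by auto
      then obtain B where B: "B \<in> P2" "v \<in> B" using partition_onD1[OF h(3)] by auto
      show "A \<in> P2"
        using color_class_block_coloring[OF h(1,2) A v]
          color_class_block_coloring[OF h(3,4) B] B h(5) by simp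
    qed
    have PP: "P = P'"
      using sub[of P g P' g'] sub[of P' g' P g] P P' eq by (auto simp: V_def)
    have "g A = g' A" if A: "A \<in> P" for A
    proof -
      obtain v where v: "v \<in> A" using A partition_onD3[OF P(1)] by (metis all_not_in_conv)
      show ?thesis
        using block_coloring_eq[OF P(1) A v, of g] block_coloring_eq[OF P(1) A v, of g'] eq PP
        by simp
    qed
    then show "P = P' \<and> g = g'"
      using PP P(3) P'(3) by (auto intro: PiE_ext)
  qed
  moreover have "?h ` Sigma ?Q ?I \<subseteq> proper_colorings G C"
  proof clarify
    fix P :: "'a set set" and g :: "'a set \<Rightarrow> 'c"
    assume P: "partition_on (pverts G) P" "\<forall>A\<in>P. stable_set G A" and g: "g \<in> P \<rightarrow>\<^sub>E C" "inj_on g P"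
    have 1: "block_coloring (pverts G) P g v \<in> C" if v: "v \<in> pverts G" for v
    proof -
      obtain A where A: "A \<in> P" "v \<in> A" using v partition_onD1[OF P(1)] by auto
      then show ?thesis using block_coloring_eq[OF P(1) A, of g] g by auto
    qed
    have 2: "(u, v) \<notin> parcs G" if uv: "u \<in> pverts G" "v \<in> pverts G"
      "block_coloring (pverts G) P g u = block_coloring (pverts G) P g v" for u v
    proof -
      obtain A where A: "A \<in> P" "v \<in> A" using uv partition_onD1[OF P(1)] by auto
      have "u \<in> A" using color_class_block_coloring[OF P(1) g(2) A] uv by blast
      then show ?thesis using P(2) A by (auto simp: stable_set_def)
    qed
    show "block_coloring (pverts G) P g \<in> proper_colorings G C"
      using 1 2 by (auto simp: proper_colorings_def block_coloring_def)
  qed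
  moreover have "proper_colorings G C \<subseteq> ?h ` Sigma ?Q ?I"
  proof
    fix f assume f: "f \<in> proper_colorings G C"
    define cls where "cls v = {w \<in> pverts G. f w = f v}" for v
    define P where "P = cls ` pverts G"
    \<comment> \<open>Any representative serves, since \<open>f\<close> is constant on each
      class.\<close>
    define g where "g = (\<lambda>A\<in>P. f (SOME v. v \<in> A))"
    have part: "partition_on (pverts G) P"
      by (rule partition_onI) (auto simp: P_def cls_def disjnt_def)
    have gc: "g (cls v) = f v" if "v \<in> pverts G" for v
    proof -
      have "(SOME w. w \<in> cls v) \<in> cls v"
        using that someI[of "\<lambda>w. w \<in> cls v" v] by (simp add: cls_def)
      then show ?thesis using that by (auto simp: g_def P_def cls_def)
    qed
    have "inj_on g P"
      by (rule inj_onI) (auto simp: P_def gc, auto simp: cls_def)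
    moreover have "g \<in> P \<rightarrow>\<^sub>E C"
    proof (rule PiE_I)
      show "g A \<in> C" if "A \<in> P" for A
        using that gc f by (auto simp: P_def proper_colorings_def)
    qed (simp add: g_def)
    moreover have "\<forall>A\<in>P. stable_set G A"
      using f unfolding P_def stable_set_def cls_def proper_colorings_def by fastforce
    moreover have "f = block_coloring (pverts G) P g"
    proof
      fix v
      show "f v = block_coloring (pverts G) P g v"
      proof (cases "v \<in> pverts G")
        case True
        then show ?thesis
          using block_coloring_eq[OF part, of "cls v" v g] gc by (auto simp: P_def cls_def)
      next
        case False
        then show ?thesis
          using f by (auto simp: proper_colorings_def block_coloring_def PiE_def extensional_def)
      qed
    qed
    ultimately show "f \<in> ?h ` Sigma ?Q ?I"
      using part by (intro image_eqI[of _ _ "(P, g)"]) auto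
  qed
  ultimately show ?thesis by (auto simp: bij_betw_def)
qed

text \<open>Truncated subtraction is harmless: for \<open>k > x\<close> the factor at
  \<open>i = x\<close> is already 0.\<close>

definition falling_factorial :: "nat \<Rightarrow> nat \<Rightarrow> nat" where
  "falling_factorial x k = (\<Prod>i<k. x - i)"

text \<open>This is the chromatic polynomial at \<open>card C\<close> in the falling factorial
  basis. The pairs from \<open>bij_betw_block_coloring\<close> are grouped by the number
  \<open>k\<close> of blocks; each such partition has \<open>falling_factorial (card C) k\<close>
  injective colorings.\<close>

lemma card_proper_colorings:
  fixes G :: "'a pair_pre_digraph"
  assumes fin: "finite (pverts G)" "finite C"
  shows "card (proper_colorings G C) =
    (\<Sum>k\<le>card (pverts G). graphical_stirling G k * falling_factorial (card C) k)"
proof -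
  define Q where "Q = {P. partition_on (pverts G) P \<and> (\<forall>A\<in>P. stable_set G A)}"
  have Qk: "stable_partitions G k = {P \<in> Q. card P = k}" for k
    by (auto simp: Q_def stable_partitions_def)
  have finP: "finite P" if "P \<in> Q" for P
    using that finite_elements[OF fin(1)] by (auto simp: Q_def)
  have finQ: "finite Q"
    using finitely_many_partition_on[OF fin(1)] by (rule rev_finite_subset) (auto simp: Q_def)
  \<comment> \<open>Ensures that grouping by \<open>k\<close> up to the number of vertices misses no
    partition.\<close>
  have le: "card P \<le> card (pverts G)" if "P \<in> Q" for P
  proof (rule ccontr)
    assume "\<not> ?thesis"
    then have "graphical_stirling G (card P) = 0"
      using graphical_stirling_eq_0[OF fin(1)] by simp
    moreover have "P \<in> stable_partitions G (card P)" "finite (stable_partitions G (card P))"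
      using that finQ by (auto simp: Qk)
    ultimately show False by (auto simp: graphical_stirling_def)
  qed
  have inj: "card {g \<in> P \<rightarrow>\<^sub>E C. inj_on g P} = falling_factorial (card C) (card P)" if "P \<in> Q" for P
    using card_inj_on_subset_funcset[OF finP[OF that] fin(2) order_refl]
    by (simp add: atLeast0LessThan falling_factorial_def)
  have "card (proper_colorings G C) = card (SIGMA P:Q. {g \<in> P \<rightarrow>\<^sub>E C. inj_on g P})"
    using bij_betw_same_card[OF bij_betw_block_coloring[of G C]] by (simp add: Q_def)
  also have "\<dots> = (\<Sum>P\<in>Q. card {g \<in> P \<rightarrow>\<^sub>E C. inj_on g P})"
    using finP finQ fin(2) by (intro card_SigmaI) (auto intro!: finite_Collect_conjI disjI1 finite_PiE)
  also have "\<dots> = (\<Sum>P\<in>Q. falling_factorial (card C) (card P))"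
    using inj by simp
  also have "\<dots> = (\<Sum>k\<le>card (pverts G). \<Sum>P | P \<in> Q \<and> card P = k. falling_factorial (card C) (card P))"
    using le by (intro sum.group[symmetric] finQ) auto
  also have "\<dots> = (\<Sum>k\<le>card (pverts G). graphical_stirling G k * falling_factorial (card C) k)"
    by (intro sum.cong refl) (simp add: graphical_stirling_def Qk)
  finally show ?thesis .
qed

section \<open>Dobinski-type series\<close>

lemma falling_factorial_over_fact:
  "real (falling_factorial x k) / fact x = (if k \<le> x then 1 / fact (x - k) else 0)"
proof (induction k)
  case 0
  show ?case by (simp add: falling_factorial_def)
next
  case (Suc k)
  have step: "real (falling_factorial x (Suc k)) / fact x =
      real (x - k) * (real (falling_factorial x k) / fact x)"
    by (simp add: falling_factorial_def)
  show ?case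
  proof (cases "Suc k \<le> x")
    case True
    then have "x - k = Suc (x - Suc k)" by simp
    then have "(fact (x - k) :: real) = real (x - k) * fact (x - Suc k)"
      using fact_Suc by metis
    with True show ?thesis
      unfolding step Suc by simp
  next
    case False
    then show ?thesis unfolding step Suc by simp
  qed
qed

text \<open>The first \<open>k\<close> terms vanish, and the rest is the exponential series at 1
  shifted by \<open>k\<close>.\<close>

lemma falling_factorial_sums: "(\<lambda>x. real (falling_factorial x k) / fact x) sums exp 1"
proof -
  have "(\<lambda>x. real (falling_factorial (x + k) k) / fact (x + k)) sums exp 1"
    using exp_converges[of "1::real"] by (simp add: falling_factorial_over_fact inverse_eq_divide)
  moreover have "(\<Sum>x<k. real (falling_factorial x k) / fact x) = 0"
    by (intro sum.neutral) (simp add: falling_factorial_over_fact)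
  ultimately show ?thesis
    using sums_iff_shift[of "\<lambda>x. real (falling_factorial x k) / fact x" k "exp 1"] by simp
qed

text \<open>Writing (x)_k for the falling factorial, x (x)_k = (x)_(k+1) + k (x)_k splits the series
  into two instances of the previous one.\<close>

lemma falling_factorial_mult_sums:
  "(\<lambda>x. real x * (real (falling_factorial x k) / fact x)) sums (exp 1 * (real k + 1))"
proof -
  have "real x * real (falling_factorial x k) =
      real (falling_factorial x (Suc k)) + real k * real (falling_factorial x k)" for x
  proof -
    have *: "falling_factorial x (Suc k) = falling_factorial x k * (x - k)"
      by (simp add: falling_factorial_def)
    show ?thesis
    proof (cases "k \<le> x")
      case True
      then show ?thesis by (simp add: * of_nat_diff right_diff_distrib)
    next
      case False
      then have "falling_factorial x k = 0"
        unfolding falling_factorial_def by (intro prod_zero) auto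
      then show ?thesis by (simp add: *)
    qed
  qed
  then have eq: "real x * (real (falling_factorial x k) / fact x) =
      real (falling_factorial x (Suc k)) / fact x + real k * (real (falling_factorial x k) / fact x)" for x
    by (simp add: add_divide_distrib)
  have "(\<lambda>x. real (falling_factorial x (Suc k)) / fact x +
      real k * (real (falling_factorial x k) / fact x)) sums (exp 1 + real k * exp 1)"
    by (intro sums_add sums_mult falling_factorial_sums)
  then show ?thesis
    unfolding eq by (simp add: distrib_left mult.commute add.commute)
qed

text \<open>Up to a factor e this is the Poisson(1) mass at \<open>x\<close> times the chromatic
  polynomial at \<open>x\<close>.\<close>

definition poisson_weight :: "'a pair_pre_digraph \<Rightarrow> nat \<Rightarrow> real" where
  "poisson_weight G x = real (card (proper_colorings G {..<x})) / fact x"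

lemma poisson_weight_eq:
  assumes "finite (pverts G)"
  shows "poisson_weight G x = (\<Sum>k\<le>card (pverts G).
    real (graphical_stirling G k) * (real (falling_factorial x k) / fact x))"
  by (simp add: poisson_weight_def card_proper_colorings[OF assms] sum_divide_distrib)

lemma poisson_weight_sums:
  assumes "finite (pverts G)"
  shows "poisson_weight G sums (exp 1 * real (graphical_bell G))"
proof -
  have "(\<lambda>x. \<Sum>k\<le>card (pverts G).
      real (graphical_stirling G k) * (real (falling_factorial x k) / fact x))
    sums (\<Sum>k\<le>card (pverts G). real (graphical_stirling G k) * exp 1)"
    by (intro sums_sum sums_mult falling_factorial_sums)
  moreover have "(\<Sum>k\<le>card (pverts G). real (graphical_stirling G k) * exp 1) =
      exp 1 * real (graphical_bell G)"
    by (simp add: graphical_bell_def sum_distrib_left mult.commute)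
  ultimately show ?thesis
    by (simp only: poisson_weight_eq[OF assms, abs_def])
qed

text \<open>A partition into \<open>k\<close> blocks contributes e (k + 1), which gives the Bell
  number plus the total number of colors.\<close>

lemma poisson_weight_mult_sums:
  assumes "finite (pverts G)"
  shows "(\<lambda>x. real x * poisson_weight G x) sums
    (exp 1 * (real (graphical_bell G) + real (total_colors G)))"
proof -
  have "(\<lambda>x. \<Sum>k\<le>card (pverts G).
      real (graphical_stirling G k) * (real x * (real (falling_factorial x k) / fact x)))
    sums (\<Sum>k\<le>card (pverts G). real (graphical_stirling G k) * (exp 1 * (real k + 1)))"
    by (intro sums_sum sums_mult falling_factorial_mult_sums)
  moreover have "(\<Sum>k\<le>card (pverts G). real (graphical_stirling G k) * (exp 1 * (real k + 1))) =
      exp 1 * (real (graphical_bell G) + real (total_colors G))"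
    by (simp add: graphical_bell_def total_colors_def sum_distrib_left sum.distrib algebra_simps)
  moreover have "real x * poisson_weight G x = (\<Sum>k\<le>card (pverts G).
      real (graphical_stirling G k) * (real x * (real (falling_factorial x k) / fact x)))" for x
    unfolding poisson_weight_eq[OF assms] sum_distrib_left
    by (intro sum.cong refl) (simp only: mult.left_commute)
  ultimately show ?thesis by simp
qed

section \<open>Colorings of cycles and isolated vertices\<close>

lemma card_proper_colorings_add_isolated:
  fixes G :: "'a pair_pre_digraph" and C :: "'c set"
  shows "card (proper_colorings (add_isolated G p) C) = card C ^ p * card (proper_colorings G C)"
proof -
  define V where "V = pverts G"
  \<comment> \<open>The values \<open>undefined\<close> off the vertex sets keep the glued function
    extensional.\<close>
  define h where "h = (\<lambda>(f, g). \<lambda>w. case w of Inl v \<Rightarrow> (if v \<in> V then f v else undefined)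
     | Inr i \<Rightarrow> (if i < p then g i else (undefined :: 'c)))"
  have "bij_betw h (proper_colorings G C \<times> ({..<p} \<rightarrow>\<^sub>E C)) (proper_colorings (add_isolated G p) C)"
  proof (rule bij_betw_byWitness[where f' = "\<lambda>k. (\<lambda>v\<in>V. k (Inl v), \<lambda>i\<in>{..<p}. k (Inr i))"])
    show "\<forall>a\<in>proper_colorings G C \<times> ({..<p} \<rightarrow>\<^sub>E C).
       (\<lambda>v\<in>V. h a (Inl v), \<lambda>i\<in>{..<p}. h a (Inr i)) = a"
      by (auto simp: h_def proper_colorings_def V_def fun_eq_iff PiE_def extensional_def)
    show "\<forall>k\<in>proper_colorings (add_isolated G p) C.
       h (\<lambda>v\<in>V. k (Inl v), \<lambda>i\<in>{..<p}. k (Inr i)) = k"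
      by (auto simp: h_def proper_colorings_def V_def fun_eq_iff PiE_def extensional_def
            add_isolated_def split: sum.splits)
    show "h ` (proper_colorings G C \<times> ({..<p} \<rightarrow>\<^sub>E C)) \<subseteq> proper_colorings (add_isolated G p) C"
      by (auto simp: h_def proper_colorings_def V_def PiE_def Pi_def extensional_def
            add_isolated_def split: sum.splits)
    show "(\<lambda>k. (\<lambda>v\<in>V. k (Inl v), \<lambda>i\<in>{..<p}. k (Inr i))) ` proper_colorings (add_isolated G p) C
        \<subseteq> proper_colorings G C \<times> ({..<p} \<rightarrow>\<^sub>E C)"
      by (auto simp: proper_colorings_def V_def PiE_def Pi_def extensional_def add_isolated_def)
  qed
  from bij_betw_same_card[OF this] show ?thesis
    by (simp add: card_cartesian_product card_funcsetE mult.commute)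
qed

section \<open>Counting colorings of paths and cycles\<close>

definition path_colorings :: "nat \<Rightarrow> 'c set \<Rightarrow> (nat \<Rightarrow> 'c) set" where
  "path_colorings n C = {f \<in> {..<n} \<rightarrow>\<^sub>E C. \<forall>i. Suc i < n \<longrightarrow> f i \<noteq> f (Suc i)}"

lemma finite_path_colorings [simp]: "finite C \<Longrightarrow> finite (path_colorings n C)"
  unfolding path_colorings_def
  by (rule finite_subset[of _ "{..<n} \<rightarrow>\<^sub>E C"]) (auto intro!: finite_PiE)

text \<open>The new vertex \<open>n\<close> may take any color but that of its only neighbour
  \<open>n - 1\<close>.\<close>

lemma path_colorings_Suc:
  assumes "0 < n"
  shows "path_colorings (Suc n) C =
    (\<lambda>(f, c). f(n := c)) ` (SIGMA f:path_colorings n C. C - {f (n - 1)})"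
proof (intro set_eqI iffI)
  fix h assume h: "h \<in> path_colorings (Suc n) C"
  have "h(n := undefined) \<in> path_colorings n C"
    using h by (auto simp: path_colorings_def PiE_def Pi_def extensional_def)
  moreover have "h n \<in> C - {(h(n := undefined)) (n - 1)}"
    using h assms by (cases n) (auto simp: path_colorings_def)
  ultimately show "h \<in> (\<lambda>(f, c). f(n := c)) ` (SIGMA f:path_colorings n C. C - {f (n - 1)})"
    by (intro image_eqI[of _ _ "(h(n := undefined), h n)"]) auto
next
  fix h assume "h \<in> (\<lambda>(f, c). f(n := c)) ` (SIGMA f:path_colorings n C. C - {f (n - 1)})"
  then show "h \<in> path_colorings (Suc n) C"
    by (auto simp: path_colorings_def PiE_def Pi_def extensional_def less_Suc_eq)
qed

lemma inj_on_path_extend: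
  fixes C :: "'a set"
  shows
  "inj_on (\<lambda>(f, c). f(n := c)) (SIGMA f:path_colorings n C. C - {f (n - 1)})"
proof (rule inj_onI)
  fix a b :: "(nat \<Rightarrow> 'a) \<times> 'a"
  assume ab: "a \<in> (SIGMA f:path_colorings n C. C - {f (n - 1)})"
      "b \<in> (SIGMA f:path_colorings n C. C - {f (n - 1)})"
      "(case a of (f, c) \<Rightarrow> f(n := c)) = (case b of (f, c) \<Rightarrow> f(n := c))"
  obtain f c f' c' where a: "a = (f, c)" "b = (f', c')" by (cases a; cases b)
  have f: "f \<in> path_colorings n C" "f' \<in> path_colorings n C" and eq: "f(n := c) = f'(n := c')"
    using ab by (auto simp: a)
  have "f n = undefined" "f' n = undefined"
    using f by (auto simp: path_colorings_def PiE_def extensional_def)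
  then show "a = b"
    using eq unfolding a by (metis fun_upd_same fun_upd_triv fun_upd_upd)
qed

lemma card_path_colorings:
  assumes "finite C"
  shows "card (path_colorings (Suc n) C) = card C * (card C - 1) ^ n"
proof (induction n)
  case 0
  have "path_colorings (Suc 0) C = {..<Suc 0} \<rightarrow>\<^sub>E C"
    by (auto simp: path_colorings_def)
  then show ?case by (simp add: card_funcsetE)
next
  case (Suc n)
  have "card (C - {f n}) = card C - 1" if "f \<in> path_colorings (Suc n) C" for f
    using that PiE_mem[of f "{..<Suc n}" "\<lambda>_. C" n] by (simp add: path_colorings_def)
  then have "card (SIGMA f:path_colorings (Suc n) C. C - {f n}) =
      card (path_colorings (Suc n) C) * (card C - 1)"
    using assms by (subst card_SigmaI) auto
  moreover have "card (path_colorings (Suc (Suc n)) C) =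
      card (SIGMA f:path_colorings (Suc n) C. C - {f n})"
    using card_image[OF inj_on_path_extend[of "Suc n" C]] by (simp add: path_colorings_Suc)
  ultimately show ?case using Suc by simp
qed

text \<open>For \<open>n >= 3\<close> these are the proper colorings of the cycle. For
  \<open>n = 1\<close> the two ends coincide and the set is empty, which starts the
  recursion.\<close>

definition open_colorings :: "nat \<Rightarrow> 'c set \<Rightarrow> (nat \<Rightarrow> 'c) set" where
  "open_colorings n C = {f \<in> path_colorings n C. f (n - 1) \<noteq> f 0}"

text \<open>Deletion-contraction for cycles: a coloring of the path on \<open>n + 1\<close> vertices
  either has different end colors, or equal ones. In the latter case dropping vertex
  \<open>n\<close> leaves a path whose last vertex differs in color from vertex 0.\<close>

lemma card_open_colorings_Suc:
  assumes "finite C" "0 < n"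
  shows "card (open_colorings (Suc n) C) + card (open_colorings n C) = card (path_colorings (Suc n) C)"
proof -
  obtain m where m: "n = Suc m" using assms(2) by (cases n) auto
  let ?closed = "{f \<in> path_colorings (Suc n) C. f n = f 0}"
  have "?closed = (\<lambda>f. f(n := f 0)) ` open_colorings n C"
  proof (intro set_eqI iffI)
    fix h assume h: "h \<in> ?closed"
    then have "h(n := undefined) \<in> open_colorings n C"
      using assms(2) by (cases n)
        (auto simp: open_colorings_def path_colorings_def PiE_def Pi_def extensional_def)
    then show "h \<in> (\<lambda>f. f(n := f 0)) ` open_colorings n C"
      using h assms(2) by (intro image_eqI[of _ _ "h(n := undefined)"]) auto
  next
    fix h assume "h \<in> (\<lambda>f. f(n := f 0)) ` open_colorings n C"
    then show "h \<in> ?closed"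
      by (auto simp: m open_colorings_def path_colorings_def PiE_def Pi_def extensional_def less_Suc_eq)
  qed
  moreover have "inj_on (\<lambda>f. f(n := f 0)) (open_colorings n C)"
  proof (rule inj_onI)
    fix f f' assume f: "f \<in> open_colorings n C" "f' \<in> open_colorings n C"
      and eq: "f(n := f 0) = f'(n := f' 0)"
    have "f n = undefined" "f' n = undefined"
      using f by (auto simp: open_colorings_def path_colorings_def PiE_def extensional_def)
    then show "f = f'" using eq by (metis fun_upd_triv fun_upd_upd)
  qed
  ultimately have closed: "card ?closed = card (open_colorings n C)"
    by (simp add: card_image)
  have "path_colorings (Suc n) C = open_colorings (Suc n) C \<union> ?closed"
    by (auto simp: open_colorings_def)
  moreover have "card (open_colorings (Suc n) C \<union> ?closed) =
      card (open_colorings (Suc n) C) + card ?closed"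
    using assms(1) by (intro card_Un_disjoint) (auto simp: open_colorings_def)
  ultimately have "card (path_colorings (Suc n) C) = card (open_colorings (Suc n) C) + card ?closed"
    by simp
  with closed show ?thesis by simp
qed

text \<open>Solves the recurrence of \<open>card_open_colorings_Suc\<close>, with value 0 at one
  vertex; the sign alternates because the previous count is subtracted.\<close>

lemma card_open_colorings:
  assumes "finite C" "C \<noteq> {}"
  shows "real (card (open_colorings (Suc n) C)) =
    (real (card C) - 1) ^ Suc n + (- 1) ^ Suc n * (real (card C) - 1)"
proof (induction n)
  case 0
  have "open_colorings (Suc 0) C = {}" by (auto simp: open_colorings_def)
  then show ?case by simp
next
  case (Suc n)
  have "0 < card C" using assms by (simp add: card_gt_0_iff)
  then have "real (card (path_colorings (Suc (Suc n)) C)) = real (card C) * (real (card C) - 1) ^ Suc n"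
    by (simp add: card_path_colorings[OF assms(1)] of_nat_diff Suc_leI)
  moreover have "real (card (open_colorings (Suc (Suc n)) C)) + real (card (open_colorings (Suc n) C)) =
      real (card (path_colorings (Suc (Suc n)) C))"
    by (metis card_open_colorings_Suc[OF assms(1)] of_nat_add zero_less_Suc)
  ultimately show ?case using Suc by (simp add: algebra_simps)
qed

lemma proper_colorings_cycle_graph:
  assumes "3 \<le> n"
  shows "proper_colorings (cycle_graph n) C = open_colorings n C"
proof -
  have 1: "(\<forall>u\<in>{..<n}. \<forall>v\<in>{..<n}. (u, v) \<in> parcs (cycle_graph n) \<longrightarrow> f u \<noteq> f v) \<longleftrightarrow>
      (\<forall>i<n. f i \<noteq> f (Suc i mod n))" for f :: "nat \<Rightarrow> 'a"
  proof -
    have "Suc i mod n < n" for i using assms by simp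
    then show ?thesis by (fastforce simp: cycle_graph_def)
  qed
  \<comment> \<open>Only the arc from \<open>n - 1\<close> to 0 wraps around; it is the condition on
    the ends.\<close>
  have 2: "(\<forall>i<n. f i \<noteq> f (Suc i mod n)) \<longleftrightarrow> (\<forall>i. Suc i < n \<longrightarrow> f i \<noteq> f (Suc i)) \<and> f (n - 1) \<noteq> f 0"
    for f :: "nat \<Rightarrow> 'a"
  proof -
    obtain m where m: "n = Suc m" using assms by (cases n) auto
    have "(\<forall>i<m. f i \<noteq> f (Suc i mod Suc m)) \<longleftrightarrow> (\<forall>i<m. f i \<noteq> f (Suc i))"
      by (simp cong: imp_cong)
    then show ?thesis by (auto simp: m All_less_Suc)
  qed
  have 3: "pverts (cycle_graph n) = {..<n}" by (simp add: cycle_graph_def)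
  show ?thesis
    unfolding proper_colorings_def open_colorings_def path_colorings_def 3 1 2 by auto
qed

lemma card_proper_colorings_cycle_graph:
  assumes "3 \<le> n" "0 < x"
  shows "real (card (proper_colorings (cycle_graph n) {..<x})) =
    (real x - 1) ^ n + (- 1) ^ n * (real x - 1)"
proof -
  obtain m where m: "n = Suc m" using assms by (cases n) auto
  show ?thesis
    using card_open_colorings[of "{..<x}" m] assms
    by (simp add: proper_colorings_cycle_graph m lessThan_empty_iff)
qed

section \<open>The ratio of the two weights\<close>

text \<open>Take \<open>c\<close> to be the value of \<open>u / v\<close> at the mean \<open>V' / V\<close>: an increasing ratio gives \<open>nonneg\<close>.\<close>

lemma crossing_mean_gt:
  fixes u v :: "nat \<Rightarrow> real"
  assumes u: "u sums U" "(\<lambda>x. real x * u x) sums U'" "0 < U"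
    and v: "v sums V" "(\<lambda>x. real x * v x) sums V'" "0 < V"
    and nonneg: "\<And>x. 0 \<le> (real x - V' / V) * (u x - c * v x)"
    and pos: "0 < (real z - V' / V) * (u z - c * v z)"
  shows "V' / V < U' / U"
proof -
  define t where "t = V' / V"
  have tV: "V' = t * V" using v(3) by (simp add: t_def)
  have "(\<lambda>x. (real x * u x - t * u x) - c * (real x * v x - t * v x)) sums
      ((U' - t * U) - c * (V' - t * V))"
    by (intro sums_diff sums_mult u v)
  \<comment> \<open>The part with \<open>c\<close> drops out because \<open>v\<close> has mean
    \<open>t\<close>.\<close>
  then have "(\<lambda>x. (real x * u x - t * u x) - c * (real x * v x - t * v x)) sums (U' - t * U)"
    by (simp add: tV)
  moreover have "(real x * u x - t * u x) - c * (real x * v x - t * v x) =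
      (real x - t) * (u x - c * v x)" for x
    by (simp add: algebra_simps)
  ultimately have s: "(\<lambda>x. (real x - t) * (u x - c * v x)) sums (U' - t * U)"
    by simp
  have "0 < (\<Sum>x. (real x - t) * (u x - c * v x))"
    using nonneg pos by (intro suminf_pos2[of _ z] sums_summable[OF s]) (auto simp: t_def)
  then have "0 < U' - t * U" using s by (simp add: sums_iff)
  then show ?thesis using u(3) by (simp add: t_def[symmetric] field_simps)
qed

text \<open>Controls the sign of the derivative of \<open>cycle_ratio\<close>. In the induction, the
  inequality for \<open>m\<close> is multiplied by \<open>y\<close>, and what remains for
  \<open>Suc m\<close> is a nonnegative multiple of \<open>y - 1\<close>. Strictness comes from the
  base case, where the gap is (y - 1)^3.\<close>

lemma power_sum_ineq:
  fixes y :: real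
  assumes "1 < y" "0 < m"
  shows "real m * y ^ (m - 1) * (y ^ 3 - 1) + (real m + 2) * y ^ m * (y - 1) < 2 * (y ^ (2 * m + 1) - 1)"
  using assms(2)
proof (induction m rule: nat_induct_non_zero)
  case 1
  have "2 * (y ^ 3 - 1) - ((y ^ 3 - 1) + 3 * y * (y - 1)) = (y - 1) ^ 3"
    by algebra
  moreover have "0 < (y - 1) ^ 3" using assms by simp
  ultimately show ?case by (simp add: numeral_3_eq_3)
next
  case (Suc m)
  define a where "a = y ^ m"
  have a: "y ^ Suc m = y * a" "y ^ (Suc m - 1) = a" "y ^ (2 * Suc m + 1) = y ^ 3 * a ^ 2"
    "y ^ (2 * m + 1) = y * a ^ 2" "y * y ^ (m - 1) = a"
    using Suc(1) by (cases m; simp add: a_def power_add power_mult power_mult_distrib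
        power2_eq_square power3_eq_cube)+
  have "1 \<le> a" unfolding a_def using assms by (intro one_le_power) simp
  \<comment> \<open>This product and the square below add up to the cofactor of \<open>y - 1\<close>
    in the remainder.\<close>
  then have "0 \<le> (a - 1) * (y ^ 2 * a - 1)"
    using assms mult_mono[of 1 "y ^ 2" 1 a] one_le_power[of y 2] by (intro mult_nonneg_nonneg) auto
  moreover have "0 \<le> (y * a - 1) ^ 2" by simp
  moreover have "(a - 1) * (y ^ 2 * a - 1) + (y * a - 1) ^ 2 =
      2 * (y ^ 2 * a ^ 2) + 2 - a * (y + 1) ^ 2"
    by algebra
  ultimately have "0 \<le> (y - 1) * (2 * (y ^ 2 * a ^ 2) + 2 - a * (y + 1) ^ 2)"
    using assms by (intro mult_nonneg_nonneg) linarith+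
  moreover have "y * (real m * y ^ (m - 1) * (y ^ 3 - 1) + (real m + 2) * y ^ m * (y - 1))
      < y * (2 * (y ^ (2 * m + 1) - 1))"
    using Suc assms by (intro mult_strict_left_mono) auto
  then have "real m * a * (y ^ 3 - 1) + (real m + 2) * (y * a) * (y - 1) < y * (2 * (y * a ^ 2 - 1))"
    unfolding a(4) a_def[symmetric] by (simp add: a(5)[symmetric] algebra_simps)
  moreover have "2 * (y ^ 3 * a ^ 2 - 1) - ((real m + 1) * a * (y ^ 3 - 1) + (real m + 1 + 2) * (y * a) * (y - 1))
    = (y * (2 * (y * a ^ 2 - 1)) - (real m * a * (y ^ 3 - 1) + (real m + 2) * (y * a) * (y - 1)))
      + (y - 1) * (2 * (y ^ 2 * a ^ 2) + 2 - a * (y + 1) ^ 2)"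
    by algebra
  ultimately show ?case unfolding a by (simp add: add.commute)
qed

text \<open>
  With \<open>m = n - 3\<close>, \<open>s = (-1) ^ n\<close> and \<open>y = x - 1\<close> this is the ratio of the chromatic polynomials of
  \<open>C\<^sub>n \<union> pK\<^sub>1\<close> and \<open>C\<^bsub>n-2\<^esub> \<union> (p+2)K\<^sub>1\<close> at \<open>x\<close>, after cancelling \<open>x ^ p * y\<close>.
\<close>

definition cycle_ratio :: "nat \<Rightarrow> real \<Rightarrow> real \<Rightarrow> real" where
  "cycle_ratio m s y = (y ^ (m + 2) + s) / ((y + 1)\<^sup>2 * (y ^ m + s))"

text \<open>The expression is the quotient rule numerator of \<open>cycle_ratio\<close> with a
  common factor \<open>y + 1\<close> removed. As s^2 = 1, it equals 2 (y^(2m+1) - 1) + s W, where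
  \<open>power_sum_ineq\<close> bounds W by the first summand; since W is nonnegative, either sign
  of \<open>s\<close> leaves it positive.\<close>

lemma cycle_ratio_deriv_numerator_pos:
  fixes y s :: real
  assumes "1 < y" "0 < m" "s = 1 \<or> s = - 1"
  shows "0 < (real m + 2) * y ^ (m + 1) * ((y + 1) * (y ^ m + s)) -
     (y ^ (m + 2) + s) * (2 * (y ^ m + s) + (y + 1) * (real m * y ^ (m - 1)))"
proof -
  define b where "b = y ^ (m - 1)"
  have b: "y ^ m = y * b" "y ^ (m + 1) = y ^ 2 * b" "y ^ (m + 2) = y ^ 3 * b"
    "y ^ (2 * m + 1) = y ^ 3 * b ^ 2"
    using assms(2) by (cases m; simp add: b_def power_add power_mult power_mult_distrib
        power2_eq_square power3_eq_cube)+
  define W where "W = real m * b * (y ^ 3 - 1) + (real m + 2) * (y * b) * (y - 1)"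
  have "W < 2 * (y ^ 3 * b ^ 2 - 1)"
    using power_sum_ineq[OF assms(1,2)] unfolding b b_def[symmetric] W_def .
  moreover have "0 \<le> W"
    unfolding W_def b_def using assms(1) by (intro add_nonneg_nonneg mult_nonneg_nonneg) auto
  ultimately have pos: "0 < 2 * (y ^ 3 * b ^ 2 - 1) + s * W"
    using assms(3) by auto
  have "s ^ 2 = 1" using assms(3) by auto
  then have "(real m + 2) * (y ^ 2 * b) * ((y + 1) * (y * b + s)) -
     (y ^ 3 * b + s) * (2 * (y * b + s) + (y + 1) * (real m * b)) = 2 * (y ^ 3 * b ^ 2 - 1) + s * W"
    unfolding W_def by algebra
  with pos show ?thesis unfolding b b_def[symmetric] by simp
qed

text \<open>For \<open>s = - 1\<close> the denominator vanishes at 1, so \<open>a\<close> must lie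
  beyond it. For \<open>s = 1\<close> the endpoint 1 is allowed, as positivity of the derivative is
  used only inside the interval.\<close>

lemma cycle_ratio_strict_mono:
  assumes "1 \<le> a" "a < b" "0 < m" "s = 1 \<or> s = - 1 \<and> 1 < a"
  shows "cycle_ratio m s a < cycle_ratio m s b"
proof -
  have pos: "0 < y ^ m + s" if "a \<le> y" for y
  proof (cases "s = 1")
    case False
    then have "1 < y ^ m" using assms that by (intro one_less_power) auto
    then show ?thesis using assms(4) False by simp
  qed (use assms that in \<open>auto intro: add_pos_pos\<close>)
  show ?thesis
  proof (rule DERIV_pos_imp_increasing_open[OF assms(2)])
    fix y assume y: "a < y" "y < b"
    define D where "D = ((real m + 2) * y ^ (m + 1) * ((y + 1) * (y ^ m + s)) -
      (y ^ (m + 2) + s) * (2 * (y ^ m + s) + (y + 1) * (real m * y ^ (m - 1)))) * (y + 1) /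
      ((y + 1)\<^sup>2 * (y ^ m + s))\<^sup>2"
    have nz: "(y + 1)\<^sup>2 * (y ^ m + s) \<noteq> 0"
      using pos[of y] y assms by simp
    have num: "((\<lambda>y. y ^ (m + 2) + s) has_real_derivative (real m + 2) * y ^ (m + 1)) (at y)"
      using DERIV_add[OF DERIV_pow[of "m + 2" y] DERIV_const[of s]] by (simp add: add.commute)
    have den: "((\<lambda>y. y ^ m + s) has_real_derivative real m * y ^ (m - 1)) (at y)"
      by (auto intro!: derivative_eq_intros)
    have square: "((\<lambda>y. (y + 1)\<^sup>2) has_real_derivative 2 * (y + 1)) (at y)"
      by (auto intro!: derivative_eq_intros)
    have "(cycle_ratio m s has_real_derivative
       (((real m + 2) * y ^ (m + 1)) * ((y + 1)\<^sup>2 * (y ^ m + s)) -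
         (y ^ (m + 2) + s) * (2 * (y + 1) * (y ^ m + s) + real m * y ^ (m - 1) * (y + 1)\<^sup>2)) /
         ((y + 1)\<^sup>2 * (y ^ m + s) * ((y + 1)\<^sup>2 * (y ^ m + s)))) (at y)"
      unfolding cycle_ratio_def[abs_def]
      by (rule DERIV_divide[OF num DERIV_mult[OF square den] nz])
    moreover have "((real m + 2) * y ^ (m + 1)) * ((y + 1)\<^sup>2 * (y ^ m + s)) -
         (y ^ (m + 2) + s) * (2 * (y + 1) * (y ^ m + s) + real m * y ^ (m - 1) * (y + 1)\<^sup>2) =
       ((real m + 2) * y ^ (m + 1) * ((y + 1) * (y ^ m + s)) -
      (y ^ (m + 2) + s) * (2 * (y ^ m + s) + (y + 1) * (real m * y ^ (m - 1)))) * (y + 1)"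
      by algebra
    ultimately have "(cycle_ratio m s has_real_derivative D) (at y)"
      by (simp add: D_def power2_eq_square)
    moreover have "0 < D"
      unfolding D_def using y assms nz
      by (intro divide_pos_pos mult_pos_pos cycle_ratio_deriv_numerator_pos zero_less_power2[THEN iffD2]) auto
    ultimately show "\<exists>l. (cycle_ratio m s has_real_derivative l) (at y) \<and> 0 < l" by blast
  next
    show "continuous_on {a..b} (cycle_ratio m s)"
      unfolding cycle_ratio_def[abs_def] using assms(1) pos
      by (intro continuous_intros ballI) (auto simp: less_imp_neq[symmetric])
  qed
qed

section \<open>Comparing the averages\<close>

lemma poisson_weight_cycle_isolated:
  assumes "3 \<le> n"
  shows "poisson_weight (add_isolated (cycle_graph n) p) x =
    (if x = 0 then 0
     else real x ^ p * ((real x - 1) ^ n + (- 1) ^ n * (real x - 1)) / fact x)"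
proof (cases "x = 0")
  case True
  have "proper_colorings (cycle_graph n) ({} :: nat set) = {}"
    using assms PiE_mem[of _ "{..<n}" "\<lambda>_. {}" 0]
    by (fastforce simp: proper_colorings_def cycle_graph_def)
  then show ?thesis
    using True by (simp add: poisson_weight_def card_proper_colorings_add_isolated)
qed (simp add: poisson_weight_def card_proper_colorings_add_isolated
      card_proper_colorings_cycle_graph[OF assms])

text \<open>The factor e is kept so that the quotient is literally that of the two series values,
  the mean of the weights.\<close>

lemma avg_colors_eq:
  assumes "finite (pverts G)" "0 < graphical_bell G"
  shows "avg_colors G = exp 1 * (real (graphical_bell G) + real (total_colors G)) /
    (exp 1 * real (graphical_bell G)) - 1"
  using assms(2) by (simp add: avg_colors_def field_simps)

text \<open>Without loops, the partition into singletons is stable.\<close>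

lemma graphical_bell_pos:
  assumes "finite (pverts G)" "\<And>v. (v, v) \<notin> parcs G"
  shows "0 < graphical_bell G"
proof -
  define P where "P = (\<lambda>v. {v}) ` pverts G"
  have card: "card P = card (pverts G)" by (simp add: P_def card_image)
  have "P \<in> stable_partitions G (card P)"
    using assms(2) partition_on_singletons by (auto simp: stable_partitions_def P_def stable_set_def)
  moreover have "finite (stable_partitions G (card P))"
    using finitely_many_partition_on[OF assms(1)]
    by (rule rev_finite_subset) (auto simp: stable_partitions_def)
  ultimately have "0 < graphical_stirling G (card P)"
    by (auto simp: graphical_stirling_def card_gt_0_iff)
  then show ?thesis
    unfolding graphical_bell_def by (subst sum_pos2[of _ "card P"]) (auto simp: card)
qed

lemma graphical_bell_cycle_isolated_pos:
  assumes "3 \<le> n"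
  shows "0 < graphical_bell (add_isolated (cycle_graph n) p)"
proof (rule graphical_bell_pos)
  interpret pair_graph "add_isolated (cycle_graph n) p"
    by (intro pair_graph_add_isolated pair_graph_cycle_graph assms)
  show "finite (pverts (add_isolated (cycle_graph n) p))" by simp
  show "(v, v) \<notin> parcs (add_isolated (cycle_graph n) p)" for v
    using pair_no_loops by force
qed

theorem theorem22:
  fixes n p :: nat
  assumes "n \<ge> 5"
  shows "avg_colors (add_isolated (cycle_graph n) p)
       > avg_colors (add_isolated (cycle_graph (n - 2)) (p + 2))"
proof -
  define m where "m = n - 3"
  have m: "n = m + 3" "n - 2 = m + 1" "0 < m" "3 \<le> n" "3 \<le> n - 2"
    using assms by (auto simp: m_def)
  \<comment> \<open>The cycle lengths \<open>m + 3\<close> and \<open>m + 1\<close> have equal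
    parity, so one sign serves both polynomials.\<close>
  define s :: real where "s = (- 1) ^ (m + 1)"
  have s: "s = 1 \<or> s = - 1" unfolding s_def by (rule minus_one_power_iff[THEN ssubst]) simp
  have s': "(- 1) ^ (m + 3) = s" by (simp add: s_def power_add)
  let ?G = "add_isolated (cycle_graph n) p" and ?H = "add_isolated (cycle_graph (n - 2)) (p + 2)"
  define u where "u = poisson_weight ?G"
  define v where "v = poisson_weight ?H"
  have fin: "finite (pverts ?G)" "finite (pverts ?H)"
    by (auto simp: add_isolated_def cycle_graph_def)
  define U where "U = exp 1 * real (graphical_bell ?G)"
  define U' where "U' = exp 1 * (real (graphical_bell ?G) + real (total_colors ?G))"
  define V where "V = exp 1 * real (graphical_bell ?H)"
  define V' where "V' = exp 1 * (real (graphical_bell ?H) + real (total_colors ?H))"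
  have U: "u sums U" "(\<lambda>x. real x * u x) sums U'" "0 < U"
    using poisson_weight_sums[OF fin(1)] poisson_weight_mult_sums[OF fin(1)]
      graphical_bell_cycle_isolated_pos[OF m(4), of p] by (auto simp: u_def U_def U'_def)
  have V: "v sums V" "(\<lambda>x. real x * v x) sums V'" "0 < V"
    using poisson_weight_sums[OF fin(2)] poisson_weight_mult_sums[OF fin(2)]
      graphical_bell_cycle_isolated_pos[OF m(5), of "p + 2"] by (auto simp: v_def V_def V'_def)
  have v: "v x = real x ^ (p + 2) * ((real x - 1) * ((real x - 1) ^ m + s)) / fact x" if "0 < x" for x
    using that poisson_weight_cycle_isolated[OF m(5), of "p + 2" x]
    by (simp add: v_def m(2) s_def algebra_simps)
  have u: "u x = real x ^ p * ((real x - 1) * ((real x - 1) ^ (m + 2) + s)) / fact x" if "0 < x" for x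
    using that poisson_weight_cycle_isolated[OF m(4), of p x]
    unfolding u_def m(1) s' by (simp add: algebra_simps power_add power3_eq_cube power2_eq_square)
  \<comment> \<open>The chromatic number of both cycles: 2 for even length, 3 for odd. The common
    support of \<open>u\<close> and \<open>v\<close> starts here.\<close>
  define b :: nat where "b = (if s = 1 then 2 else 3)"
  have low: "u x = 0 \<and> v x = 0" if "x < b" for x
  proof (cases "x = 0")
    case True
    then show ?thesis
      using poisson_weight_cycle_isolated[OF m(4)] poisson_weight_cycle_isolated[OF m(5)]
      by (simp add: u_def v_def)
  next
    case False
    then have "x = 1 \<or> x = 2 \<and> s = - 1"
      using that s by (auto simp: b_def split: if_splits)
    then show ?thesis using u[of x] v[of x] by auto
  qed
  have vpos: "0 < (real x - 1) ^ m + s" "0 < v x" if "b \<le> x" for x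
  proof -
    have x: "2 \<le> x" "s = 1 \<or> s = - 1 \<and> 3 \<le> x" using that s by (auto simp: b_def split: if_splits)
    show 1: "0 < (real x - 1) ^ m + s"
    proof (cases "s = 1")
      case True
      then show ?thesis using x(1) by (simp add: add_nonneg_pos)
    next
      case False
      then have "s = - 1" "1 < real x - 1" using x(2) by auto
      then show ?thesis using one_less_power[of "real x - 1" m] m(3) by simp
    qed
    show "0 < v x" using 1 x(1) v[of x] by simp
  qed
  have ratio: "u x = cycle_ratio m s (real x - 1) * v x" if "b \<le> x" for x
  proof -
    have "0 < x" using that by (auto simp: b_def split: if_splits)
    then show ?thesis
      using u[of x] v[of x] vpos(1)[OF that]
      by (simp add: cycle_ratio_def power_add power2_eq_square)
  qed
  define t where "t = V' / V"
  \<comment> \<open>The mean \<open>t\<close> of a distribution supported on \<open>x >= b\<close>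
    is at least \<open>b\<close>; this puts \<open>t\<close> in the range where the ratio is
    monotone.\<close>
  have bV: "(\<lambda>x. real x * v x - real b * v x) sums (V' - real b * V)"
    by (intro sums_diff sums_mult V)
  have "0 \<le> real x * v x - real b * v x" for x
  proof (cases "x < b")
    case False
    then have "0 \<le> (real x - real b) * v x"
      using vpos(2)[of x] by (intro mult_nonneg_nonneg) auto
    then show ?thesis by (simp add: left_diff_distrib)
  qed (simp add: low)
  then have "0 \<le> V' - real b * V"
    using sums_le[OF _ sums_zero bV] by blast
  then have t: "real b \<le> t" using V(3) by (simp add: t_def field_simps)
  \<comment> \<open>\<open>t\<close> need not be an integer, which is why the ratio is studied as a
    function of a real variable.\<close>
  define c where "c = cycle_ratio m s (t - 1)"
  have mono: "cycle_ratio m s (y - 1) < cycle_ratio m s (z - 1)" if "real b \<le> y" "y < z" for y z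
    using that s m(3) by (intro cycle_ratio_strict_mono) (auto simp: b_def split: if_splits)
  \<comment> \<open>By monotonicity, \<open>x - t\<close> and the ratio at \<open>x\<close> minus
    \<open>c\<close> have the same sign, and \<open>v x\<close> is positive.\<close>
  have pos: "0 < (real x - t) * (u x - c * v x)" if "b \<le> x" "real x \<noteq> t" for x
  proof -
    have "0 < (real x - t) * (cycle_ratio m s (real x - 1) - c)"
    proof (cases "real x < t")
      case True
      then have "cycle_ratio m s (real x - 1) < c" using mono[of "real x" t] that by (simp add: c_def)
      with True show ?thesis by (intro mult_neg_neg) auto
    next
      case False
      then have "t < real x" using that by simp
      moreover from this have "c < cycle_ratio m s (real x - 1)" using mono[OF t] by (simp add: c_def)
      ultimately show ?thesis by (intro mult_pos_pos) auto
    qed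
    then have "0 < (real x - t) * (cycle_ratio m s (real x - 1) - c) * v x"
      using vpos(2)[OF that(1)] by simp
    then show ?thesis by (simp add: ratio[OF that(1)] algebra_simps)
  qed
  have nonneg: "0 \<le> (real x - t) * (u x - c * v x)" for x
  proof (cases "x < b \<or> real x = t")
    case True
    then show ?thesis using low[of x] by auto
  next
    case False
    then show ?thesis using pos[of x] by simp
  qed
  \<comment> \<open>At least one of the support points \<open>b\<close> and \<open>Suc b\<close>
    differs from \<open>t\<close>.\<close>
  have "\<exists>z. 0 < (real z - t) * (u z - c * v z)"
  proof (cases "t = real b")
    case True
    then show ?thesis using pos[of "Suc b"] by (intro exI[of _ "Suc b"]) simp
  next
    case False
    then show ?thesis using pos[of b] by (intro exI[of _ b]) simp
  qed
  then obtain z where z: "0 < (real z - t) * (u z - c * v z)" by blast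
  have "V' / V < U' / U"
    using nonneg z unfolding t_def by (rule crossing_mean_gt[OF U V])
  then show ?thesis
    unfolding avg_colors_eq[OF fin(1) graphical_bell_cycle_isolated_pos[OF m(4)]]
      avg_colors_eq[OF fin(2) graphical_bell_cycle_isolated_pos[OF m(5)]]
      U_def U'_def V_def V'_def by linarith
qed

end
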